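(* Let $\lambda=(\lambda_n)$ be a frequency. Then there is a strictly increasing sequence $(s_n)$ of natural numbers such that the space $\mathcal{D}_\infty(\eta)$, where the frequency $\eta$ is obtained by ordering the set $$\left\{\lambda_n+\frac{j}{s_n}(\lambda_{n+1}-\lambda_n)\ \middle|\ n\in\mathbf{N},\ j=0,\ldots,s_n-1\right\}$$ increasingly, is not complete.
   Context: A frequency is a strictly increasing sequence $\lambda=(\lambda_n)_{n\in\mathbf{N}}$ of non-negative real numbers tending to $+\infty$ ($\mathbf{N}=\{1,2,\dots\}$). For a frequency $\eta=(\eta_m)$, an $\eta$-Dirichlet series is a formal sum $D=\sum_{m\ge 1} a_m e^{-\eta_m s}$ with complex coefficients $a_m$ and complex variable $s$. $[Re>0]=\{s\in\mathbf{C}: \mathrm{Re}\,s>0\}$. $\mathcal{D}_\infty(\eta)$ is the space of all $\eta$-Dirichlet series $D$ which converge on $[Re>0]$ and define a bounded function there, with norm $\|D\|_\infty:=\sup_{[Re>0]}|D(s)|$. *)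

theory Defs
  imports "HOL-Analysis.Analysis"
begin

text \<open>
  Sequences that the literature indexes by \<open>1, 2, \<dots>\<close> are indexed by \<open>0, 1, \<dots>\<close> here:
  \<open>\<Lambda> n\<close> stands for the \<open>(n+1)\<close>-st entry of the frequency, and similarly for
  coefficient sequences.
\<close>

definition frequency :: "(nat \<Rightarrow> real) \<Rightarrow> bool" where
  "frequency \<eta> \<longleftrightarrow> strict_mono \<eta> \<and> (\<forall>n. 0 \<le> \<eta> n) \<and> filterlim \<eta> at_top sequentially"

text \<open>
  A formal Dirichlet series over \<open>\<eta>\<close> is represented by its coefficient sequence \<open>a\<close>.
  Convergence is plain (conditional) convergence of the series in its given order.
\<close>

definition dirichlet_term :: "(nat \<Rightarrow> real) \<Rightarrow> (nat \<Rightarrow> complex) \<Rightarrow> complex \<Rightarrow> nat \<Rightarrow> complex" where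
  "dirichlet_term \<eta> a z m = a m * exp (- (complex_of_real (\<eta> m) * z))"

definition dirichlet_value :: "(nat \<Rightarrow> real) \<Rightarrow> (nat \<Rightarrow> complex) \<Rightarrow> complex \<Rightarrow> complex" where
  "dirichlet_value \<eta> a z = (\<Sum>m. dirichlet_term \<eta> a z m)"

definition D_infty :: "(nat \<Rightarrow> real) \<Rightarrow> (nat \<Rightarrow> complex) set" where
  "D_infty \<eta> = {a. (\<forall>z. 0 < Re z \<longrightarrow> summable (dirichlet_term \<eta> a z)) \<and>
                    bounded (dirichlet_value \<eta> a ` {z. 0 < Re z})}"

definition D_infty_norm :: "(nat \<Rightarrow> real) \<Rightarrow> (nat \<Rightarrow> complex) \<Rightarrow> real" where
  "D_infty_norm \<eta> a = (SUP z\<in>{z. 0 < Re z}. cmod (dirichlet_value \<eta> a z))"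

text \<open>
  The distance induced by the norm. The value \<open>0\<close> off \<open>D_infty\<close> is only there because
  \<^locale>\<open>Metric_space\<close> demands a globally nonnegative symmetric function; metric notions on
  \<open>D_infty\<close> do not depend on it.
\<close>

definition D_infty_dist :: "(nat \<Rightarrow> real) \<Rightarrow> (nat \<Rightarrow> complex) \<Rightarrow> (nat \<Rightarrow> complex) \<Rightarrow> real" where
  "D_infty_dist \<eta> a b =
     (if a \<in> D_infty \<eta> \<and> b \<in> D_infty \<eta> then D_infty_norm \<eta> (\<lambda>m. a m - b m) else 0)"

definition refinement :: "(nat \<Rightarrow> real) \<Rightarrow> (nat \<Rightarrow> nat) \<Rightarrow> real set" where
  "refinement \<Lambda> s =
     {\<Lambda> n + real j / real (s n) * (\<Lambda> (Suc n) - \<Lambda> n) | n j. j < s n}"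

text \<open>
  An increasing enumeration of a set of reals by the natural numbers is unique, so ``the
  frequency obtained by ordering \<open>S\<close> increasingly'' may be rendered as a frequency with range \<open>S\<close>.
\<close>

lemma frequency_range_unique:
  assumes "frequency \<eta>" "frequency \<theta>" "range \<eta> = range \<theta>"
  shows "\<eta> = \<theta>"
proof
  fix n
  have sm: "strict_mono \<eta>" "strict_mono \<theta>"
    using assms by (auto simp: frequency_def)
  show "\<eta> n = \<theta> n"
  proof (induction n rule: less_induct)
    case (less n)
    obtain k where k: "\<eta> n = \<theta> k" using assms(3) by blast
    obtain l where l: "\<theta> n = \<eta> l" using assms(3) by (metis rangeE rangeI)
    have "\<not> k < n" using less k sm(1) by (metis less_irrefl strict_mono_less)
    moreover have "\<not> l < n" using less l sm(2) by (metis less_irrefl strict_mono_less)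
    ultimately have "\<theta> n \<le> \<eta> n" "\<eta> n \<le> \<theta> n"
      using strict_mono_less_eq[OF sm(2), of n k] strict_mono_less_eq[OF sm(1), of n l]
      by (simp_all only: k l not_less)
    then show ?case by simp
  qed
qed

text \<open>
  \<open>D_infty\<close> is a metric space. The only nontrivial point is that a Dirichlet series
  vanishing on the half plane has zero coefficients.
\<close>

lemma norm_sum_decreasing_weights:
  fixes c :: "nat \<Rightarrow> complex" and d :: "nat \<Rightarrow> real"
  assumes B: "\<And>n. cmod (\<Sum>k<n. c k) \<le> B" and d: "decseq d" "\<And>n. 0 \<le> d n"
  shows "cmod (\<Sum>k<n. c k * of_real (d k)) \<le> B * d 0"
proof -
  define C where "C n = (\<Sum>k<n. c k)" for n
  have step: "0 \<le> d k - d (Suc k)" for k using d(1) by (simp add: decseq_Suc_iff)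
  have B0: "0 \<le> B" using B[of 0] by simp
  have parts: "(\<Sum>k<n. c k * of_real (d k)) =
      C n * of_real (d n) + (\<Sum>k<n. C (Suc k) * of_real (d k - d (Suc k)))"
    by (induction n) (simp_all add: C_def algebra_simps)
  have tele: "(\<Sum>k<n. d k - d (Suc k)) = d 0 - d n"
    by (induction n) simp_all
  have "cmod (C n * of_real (d n)) \<le> B * d n"
    using B[of n] d(2)[of n] by (simp add: C_def norm_mult mult_right_mono)
  moreover have "cmod (\<Sum>k<n. C (Suc k) * of_real (d k - d (Suc k))) \<le> (\<Sum>k<n. B * (d k - d (Suc k)))"
  proof (rule sum_norm_le)
    fix k
    have "cmod (C (Suc k)) \<le> B" using B[of "Suc k"] by (simp add: C_def)
    then show "cmod (C (Suc k) * of_real (d k - d (Suc k))) \<le> B * (d k - d (Suc k))"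
      using step[of k] by (simp only: norm_mult norm_of_real abs_of_nonneg mult_right_mono)
  qed
  moreover have "(\<Sum>k<n. B * (d k - d (Suc k))) = B * (d 0 - d n)"
    by (simp only: tele flip: sum_distrib_left)
  ultimately show ?thesis
    unfolding parts by (smt (verit) norm_triangle_ineq right_diff_distrib)
qed

lemma dirichlet_zero_coeffs:
  assumes \<eta>: "frequency \<eta>"
    and z: "\<And>z. 0 < Re z \<Longrightarrow> dirichlet_term \<eta> a z sums 0"
  shows "a m = 0"
proof (induction m rule: less_induct)
  case (less m)
  define c where "c k = a (k + Suc m) * exp (- complex_of_real (\<eta> (k + Suc m)))" for k
  have mono: "strict_mono \<eta>" using \<eta> by (simp add: frequency_def)
  have tail: "(\<lambda>k. dirichlet_term \<eta> a z (k + Suc m)) sums (- dirichlet_term \<eta> a z m)"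
    if "0 < Re z" for z
  proof -
    have "(\<Sum>k<Suc m. dirichlet_term \<eta> a z k) = dirichlet_term \<eta> a z m"
      using less by (simp add: dirichlet_term_def)
    then show ?thesis using sums_split_initial_segment[OF z[OF that], of "Suc m"] by simp
  qed
  have "c sums (- dirichlet_term \<eta> a 1 m)"
    using tail[of 1] by (simp add: c_def[abs_def] dirichlet_term_def)
  then have "convergent (\<lambda>n. \<Sum>k<n. c k)"
    unfolding sums_def convergent_def by blast
  then have "Bseq (\<lambda>n. \<Sum>k<n. c k)" by (rule convergent_imp_Bseq)
  then obtain B where B: "0 < B" "\<And>n. cmod (\<Sum>k<n. c k) \<le> B" by (auto simp: Bseq_def)
  define g where "g = \<eta> (Suc m) - \<eta> m"
  have g: "0 < g" using mono by (simp add: g_def strict_mono_less)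
  have est: "cmod (a m) * exp (- \<eta> m) \<le> B * exp (- g * real t)" for t :: nat
  proof -
    define d where "d k = exp (- \<eta> (k + Suc m) * real t)" for k
    have "decseq d"
      unfolding decseq_def d_def
      using mono by (auto simp: strict_mono_less_eq intro!: mult_right_mono)
    then have bd: "cmod (\<Sum>k<n. c k * of_real (d k)) \<le> B * d 0" for n
      by (rule norm_sum_decreasing_weights[OF B(2)]) (simp add: d_def)
    have eq: "dirichlet_term \<eta> a (of_nat (Suc t)) (k + Suc m) = c k * of_real (d k)" for k
    proof -
      have "exp (- (complex_of_real (\<eta> (k + Suc m)) * of_nat (Suc t)))
          = exp (- complex_of_real (\<eta> (k + Suc m))) * exp (- (complex_of_real (\<eta> (k + Suc m)) * of_nat t))"
        by (simp add: algebra_simps flip: exp_add)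
      moreover have "of_real (d k) = exp (- (complex_of_real (\<eta> (k + Suc m)) * of_nat t))"
        by (simp add: d_def exp_of_real[symmetric])
      ultimately show ?thesis by (simp add: dirichlet_term_def c_def)
    qed
    have "(\<lambda>n. \<Sum>k<n. c k * of_real (d k)) \<longlonglongrightarrow> - dirichlet_term \<eta> a (of_nat (Suc t)) m"
      using tail[of "of_nat (Suc t)"] unfolding eq sums_def by simp
    then have "cmod (- dirichlet_term \<eta> a (of_nat (Suc t)) m) \<le> B * d 0"
      by (rule tendsto_upperbound[OF tendsto_norm]) (use bd in auto)
    then have "cmod (a m) * exp (- (\<eta> m * real (Suc t))) \<le> B * d 0"
      by (simp add: dirichlet_term_def norm_mult)
    then have "cmod (a m) * exp (- (\<eta> m * real (Suc t))) * exp (\<eta> m * real t)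
        \<le> B * d 0 * exp (\<eta> m * real t)"
      by (rule mult_right_mono) simp
    then show ?thesis
      by (simp add: d_def g_def mult.assoc algebra_simps flip: exp_add)
  qed
  have "(\<lambda>t::nat. B * exp (- g * real t)) \<longlonglongrightarrow> 0"
  proof -
    have "(\<lambda>t::nat. exp (- g) ^ t) \<longlonglongrightarrow> 0" using g by (intro LIMSEQ_realpow_zero) auto
    then have "(\<lambda>t::nat. B * exp (- g) ^ t) \<longlonglongrightarrow> B * 0" by (rule tendsto_mult_left)
    then show ?thesis by (simp add: mult.commute flip: exp_of_nat_mult)
  qed
  then have "cmod (a m) * exp (- \<eta> m) \<le> 0"
    by (rule tendsto_lowerbound) (use est in auto)
  then show ?case by (simp add: mult_le_0_iff)
qed

lemma D_infty_diff:
  assumes a: "a \<in> D_infty \<eta>" and b: "b \<in> D_infty \<eta>"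
  shows "(\<lambda>m. a m - b m) \<in> D_infty \<eta>"
    and "0 < Re z \<Longrightarrow> dirichlet_value \<eta> (\<lambda>m. a m - b m) z = dirichlet_value \<eta> a z - dirichlet_value \<eta> b z"
proof -
  have eq: "dirichlet_term \<eta> (\<lambda>m. a m - b m) z = (\<lambda>m. dirichlet_term \<eta> a z m - dirichlet_term \<eta> b z m)" for z
    by (auto simp: dirichlet_term_def algebra_simps)
  show val: "dirichlet_value \<eta> (\<lambda>m. a m - b m) z = dirichlet_value \<eta> a z - dirichlet_value \<eta> b z"
    if "0 < Re z" for z
    using a b that unfolding dirichlet_value_def eq by (auto simp: D_infty_def suminf_diff)
  have "bounded (dirichlet_value \<eta> (\<lambda>m. a m - b m) ` {z. 0 < Re z})"
  proof -
    have "bounded ((\<lambda>z. dirichlet_value \<eta> a z - dirichlet_value \<eta> b z) ` {z. 0 < Re z})"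
      using a b by (intro bounded_minus_comp) (auto simp: D_infty_def)
    then show ?thesis using val by (auto cong: image_cong_simp)
  qed
  then show "(\<lambda>m. a m - b m) \<in> D_infty \<eta>"
    using a b by (auto simp: D_infty_def eq intro!: summable_diff)
qed

lemma D_infty_norm_upper:
  assumes "a \<in> D_infty \<eta>" "0 < Re z"
  shows "cmod (dirichlet_value \<eta> a z) \<le> D_infty_norm \<eta> a"
proof -
  have "bdd_above ((\<lambda>z. cmod (dirichlet_value \<eta> a z)) ` {z. 0 < Re z})"
    using assms(1) by (auto simp: D_infty_def bounded_iff bdd_above_def)
  then show ?thesis unfolding D_infty_norm_def using assms(2) by (intro cSUP_upper) auto
qed

lemma D_infty_norm_least:
  assumes "\<And>z. 0 < Re z \<Longrightarrow> cmod (dirichlet_value \<eta> a z) \<le> B"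
  shows "D_infty_norm \<eta> a \<le> B"
proof -
  have "(1::complex) \<in> {z. 0 < Re z}" by simp
  then show ?thesis unfolding D_infty_norm_def using assms by (intro cSUP_least) blast+
qed

lemma Metric_space_D_infty:
  assumes "frequency \<eta>"
  shows "Metric_space (D_infty \<eta>) (D_infty_dist \<eta>)"
proof
  fix x y
  show "0 \<le> D_infty_dist \<eta> x y"
    using D_infty_norm_upper[of "\<lambda>m. x m - y m" \<eta> 1] D_infty_diff(1)[of x \<eta> y]
    unfolding D_infty_dist_def by (auto intro: order_trans[OF norm_ge_zero])
  have "D_infty_norm \<eta> (\<lambda>m. x m - y m) = D_infty_norm \<eta> (\<lambda>m. y m - x m)"
    if "x \<in> D_infty \<eta>" "y \<in> D_infty \<eta>"
    unfolding D_infty_norm_def using that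
    by (intro SUP_cong) (auto simp: D_infty_diff(2) norm_minus_commute)
  then show "D_infty_dist \<eta> x y = D_infty_dist \<eta> y x"
    by (auto simp: D_infty_dist_def)
next
  fix x y assume x: "x \<in> D_infty \<eta>" and y: "y \<in> D_infty \<eta>"
  have d: "(\<lambda>m. x m - y m) \<in> D_infty \<eta>" using x y by (rule D_infty_diff)
  show "D_infty_dist \<eta> x y = 0 \<longleftrightarrow> x = y"
  proof
    assume 0: "D_infty_dist \<eta> x y = 0"
    have "dirichlet_term \<eta> (\<lambda>m. x m - y m) z sums 0" if "0 < Re z" for z
    proof -
      have "dirichlet_value \<eta> (\<lambda>m. x m - y m) z = 0"
        using D_infty_norm_upper[OF d that] 0 x y by (simp add: D_infty_dist_def)
      moreover have "summable (dirichlet_term \<eta> (\<lambda>m. x m - y m) z)"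
        using d that by (simp add: D_infty_def)
      ultimately show ?thesis by (metis dirichlet_value_def summable_sums)
    qed
    from dirichlet_zero_coeffs[OF assms this] show "x = y" by (auto simp: fun_eq_iff)
  next
    assume "x = y"
    then have "D_infty_dist \<eta> x y = (SUP z\<in>{z::complex. 0 < Re z}. 0)"
      using x by (simp add: D_infty_dist_def D_infty_norm_def dirichlet_value_def dirichlet_term_def)
    also have "\<dots> = 0"
    proof (rule cSUP_const)
      have "(1::complex) \<in> {z. 0 < Re z}" by simp
      then show "{z::complex. 0 < Re z} \<noteq> {}" by blast
    qed
    finally show "D_infty_dist \<eta> x y = 0" .
  qed
next
  fix x y w assume x: "x \<in> D_infty \<eta>" and y: "y \<in> D_infty \<eta>" and w: "w \<in> D_infty \<eta>"
  have "D_infty_norm \<eta> (\<lambda>m. x m - w m) \<le> D_infty_norm \<eta> (\<lambda>m. x m - y m) + D_infty_norm \<eta> (\<lambda>m. y m - w m)"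
  proof (rule D_infty_norm_least)
    fix z :: complex assume z: "0 < Re z"
    show "cmod (dirichlet_value \<eta> (\<lambda>m. x m - w m) z)
        \<le> D_infty_norm \<eta> (\<lambda>m. x m - y m) + D_infty_norm \<eta> (\<lambda>m. y m - w m)"
      using D_infty_norm_upper[OF D_infty_diff(1)[OF x y] z]
        D_infty_norm_upper[OF D_infty_diff(1)[OF y w] z]
        norm_triangle_ineq[of "dirichlet_value \<eta> x z - dirichlet_value \<eta> y z"
          "dirichlet_value \<eta> y z - dirichlet_value \<eta> w z"]
      by (simp add: D_infty_diff(2)[OF x y z] D_infty_diff(2)[OF y w z] D_infty_diff(2)[OF x w z])
  qed
  then show "D_infty_dist \<eta> x w \<le> D_infty_dist \<eta> x y + D_infty_dist \<eta> y w"
    using x y w by (simp add: D_infty_dist_def)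
qed

end

theory Submission
  imports Defs
begin

text \<open>
  On the $n$-th block of the refined frequency, which is an arithmetic progression, one places
  the Fejer polynomial $\sum_{k=1}^{N} (w^{N-k} - w^{N+k})/k$ with $N = N_n$ and the weight
  $2^{-n}$. These polynomials are bounded on the unit disc independently of $N$, so the sums over
  the first $K$ blocks form a Cauchy sequence. A limit in $\mathcal{D}_\infty(\eta)$ would differ
  from the sum of the first $K$ blocks by $O(e^{-\lambda_K s})$ as $s \to +\infty$, which forces it
  to have the expected coefficients. But the first half of the $n$-th polynomial is of size
  $\log N_n$ near $w = 1$; if $N_n$ grows fast enough, the partial sums at $s = 1$ oscillate by
  at least $1$ inside every block, so that the series diverges there.
\<close>

section \<open>Uniform bound for the Fejer polynomials on the closed unit disc\<close>

lemma norm_geometric_sum_le: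
  fixes w :: complex
  assumes "cmod w \<le> 1" "w \<noteq> 1"
  shows "cmod (\<Sum>k=a..<b. w ^ k) \<le> 2 / cmod (1 - w)"
proof (cases "a \<le> b")
  case True
  then have "(1 - w) * (\<Sum>k=a..<b. w ^ k) = w ^ a - w ^ b"
    by (induction rule: dec_induct) (simp, simp add: distrib_left, simp add: left_diff_distrib)
  then have "cmod (1 - w) * cmod (\<Sum>k=a..<b. w ^ k) = cmod (w ^ a - w ^ b)"
    by (metis norm_mult)
  also have "\<dots> \<le> cmod (w ^ a) + cmod (w ^ b)" by (rule norm_triangle_ineq4)
  also have "\<dots> \<le> 2"
    using power_le_one[OF norm_ge_zero assms(1), of a] power_le_one[OF norm_ge_zero assms(1), of b]
    by (simp add: norm_power)
  finally show ?thesis using assms(2) by (simp add: field_simps)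
qed auto

lemma norm_one_minus_power_le:
  fixes w :: complex
  assumes "cmod w \<le> 1"
  shows "cmod (1 - w ^ k) \<le> real k * cmod (1 - w)"
proof (induction k)
  case (Suc k)
  have "1 - w ^ Suc k = (1 - w ^ k) + w ^ k * (1 - w)" by (simp add: algebra_simps)
  then have "cmod (1 - w ^ Suc k) \<le> cmod (1 - w ^ k) + cmod w ^ k * cmod (1 - w)"
    by (metis norm_mult norm_power norm_triangle_ineq)
  also have "\<dots> \<le> real k * cmod (1 - w) + 1 * cmod (1 - w)"
    by (intro add_mono Suc mult_right_mono power_le_one assms) auto
  finally show ?case by (simp add: algebra_simps)
qed simp

text \<open>Partial summation: the unweighted sums are at most \<open>2 / \<delta>\<close> and the
  largest weight \<open>1 / Suc M\<close> is at most \<open>\<delta>\<close>. Keeping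
  \<open>f\<close> abstract lets the same estimate serve the ascending powers
  \<open>w ^ (N + Suc k)\<close> and the descending powers \<open>w ^ (N - Suc k)\<close>.\<close>

lemma norm_fejer_half_tail_le:
  fixes f :: "nat \<Rightarrow> complex"
  assumes "\<And>n. n \<le> N \<Longrightarrow> cmod (\<Sum>k=M..<n. f (Suc k)) \<le> 2 / \<delta>" "0 < \<delta>" "1 \<le> \<delta> * real (Suc M)"
  shows "cmod (\<Sum>k=M..<N. f (Suc k) / of_nat (Suc k)) \<le> 2"
proof (cases "M \<le> N")
  case True
  \<comment> \<open>Partial summation with decreasing weights needs a sequence starting at 0 and a
    bound on all of its partial sums. Hence the shift by \<open>M\<close>, and the cut-off at
    \<open>N\<close>, beyond which nothing is assumed.\<close>
  define c where "c k = (if M + k < N then f (Suc (M + k)) else 0)" for k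
  define d where "d k = 1 / real (Suc (M + k))" for k
  have cs: "(\<Sum>k<n. c k * h (M + k)) = (\<Sum>k=M..<min N (M + n). f (Suc k) * h k)" for n and h :: "nat \<Rightarrow> complex"
    using True by (induction n) (auto simp: c_def min_def le_Suc_eq)
  have "cmod (\<Sum>k<n. c k) \<le> 2 / \<delta>" for n
    using assms(1)[of "min N (M + n)"] cs[of "\<lambda>_. 1" n] by simp
  then have "cmod (\<Sum>k<N - M. c k * of_real (d k)) \<le> 2 / \<delta> * d 0"
    by (rule norm_sum_decreasing_weights) (auto simp: d_def decseq_def frac_le)
  also have "\<dots> \<le> 2" using assms(2,3) by (simp add: d_def field_simps)
  finally have "cmod (\<Sum>k<N - M. c k * of_real (d k)) \<le> 2" .
  moreover have "(\<Sum>k<N - M. c k * of_real (d k)) = (\<Sum>k=M..<N. f (Suc k) / of_nat (Suc k))"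
    using cs[of "\<lambda>k. 1 / of_nat (Suc k)" "N - M"] True by (simp add: d_def)
  ultimately show ?thesis by simp
qed auto

lemma sum_lessThan_add:
  fixes f :: "nat \<Rightarrow> 'a::comm_monoid_add"
  shows "(\<Sum>m<a + b. f m) = (\<Sum>m<a. f m) + (\<Sum>j<b. f (a + j))"
  by (induction b) (simp_all add: add.assoc)

text \<open>
  Since \<open>1 / 0 = 0\<close>, these are the coefficients of $\sum_{k=1}^{N} (w^{N-k} - w^{N+k})/k$,
  including the vanishing one at \<open>j = N\<close>.
\<close>
definition fejer_coeff :: "nat \<Rightarrow> nat \<Rightarrow> real" where
  "fejer_coeff N j = 1 / (real N - real j)"

text \<open>The coefficients are antisymmetric about \<open>j = N\<close>. Pairing the positions
  \<open>N - Suc k\<close> and \<open>N + Suc k\<close> exposes the differences of powers that are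
  small near \<open>w = 1\<close>.\<close>

lemma fejer_poly_eq:
  fixes w :: complex
  shows "(\<Sum>j<2 * N + 1. of_real (fejer_coeff N j) * w ^ j)
      = (\<Sum>k<N. (w ^ (N - Suc k) - w ^ (N + Suc k)) / of_nat (Suc k))"
proof -
  have "(\<Sum>j<2 * N + 1. of_real (fejer_coeff N j) * w ^ j)
      = (\<Sum>j<N. of_real (fejer_coeff N j) * w ^ j)
        + (\<Sum>k<Suc N. of_real (fejer_coeff N (N + k)) * w ^ (N + k))"
    using sum_lessThan_add[of "\<lambda>j. of_real (fejer_coeff N j) * w ^ j" N "Suc N"]
    by (simp add: mult_2)
  also have "(\<Sum>j<N. of_real (fejer_coeff N j) * w ^ j)
      = (\<Sum>k<N. of_real (fejer_coeff N (N - Suc k)) * w ^ (N - Suc k))"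
    by (rule sum.nat_diff_reindex[symmetric])
  also have "\<dots> = (\<Sum>k<N. w ^ (N - Suc k) / of_nat (Suc k))"
    by (intro sum.cong) (auto simp: fejer_coeff_def of_nat_diff)
  also have "(\<Sum>k<Suc N. of_real (fejer_coeff N (N + k)) * w ^ (N + k))
      = - (\<Sum>k<N. w ^ (N + Suc k) / of_nat (Suc k))"
  proof -
    have "fejer_coeff N (N + 0) = 0" "fejer_coeff N (N + Suc k) = - 1 / real (Suc k)" for k
      by (simp_all add: fejer_coeff_def divide_simps)
    then show ?thesis
      unfolding sum.lessThan_Suc_shift by (simp add: sum_negf del: add_Suc_right)
  qed
  finally show ?thesis by (simp add: sum_subtractf diff_divide_distrib)
qed

text \<open>The constant is 2 + 2 + 2. Cancellation within the pairs bounds the head of the sum; in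
  the tail the two powers of each pair are summed separately, and each of these sums is controlled
  by the geometric series.\<close>

lemma norm_fejer_poly_le:
  fixes w :: complex
  assumes w: "cmod w \<le> 1"
  shows "cmod (\<Sum>j<2 * N + 1. of_real (fejer_coeff N j) * w ^ j) \<le> 6"
proof (cases "w = 1")
  case False
  define \<delta> where "\<delta> = cmod (1 - w)"
  have \<delta>: "0 < \<delta>" using False by (simp add: \<delta>_def)
  define M where "M = nat \<lfloor>1 / \<delta>\<rfloor>"
  have M: "\<delta> * real M \<le> 1" "1 \<le> \<delta> * real (Suc M)"
  proof -
    have "0 \<le> 1 / \<delta>" using \<delta> by simp
    then have "real M \<le> 1 / \<delta>" "1 / \<delta> \<le> real (Suc M)" unfolding M_def by linarith+
    then show "\<delta> * real M \<le> 1" "1 \<le> \<delta> * real (Suc M)" using \<delta> by (simp_all add: field_simps)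
  qed
  let ?g = "\<lambda>k. (w ^ (N - Suc k) - w ^ (N + Suc k)) / of_nat (Suc k)"
  \<comment> \<open>Factoring out the lower power leaves \<open>1 - w ^ (2 * Suc k)\<close>, whose
    linear growth in \<open>k\<close> is absorbed by the denominator.\<close>
  have small: "cmod (?g k) \<le> 2 * \<delta>" if "k < N" for k
  proof -
    have "N + Suc k = (N - Suc k) + 2 * Suc k" using that by simp
    then have "w ^ (N + Suc k) = w ^ (N - Suc k) * w ^ (2 * Suc k)" by (metis power_add)
    then have "w ^ (N - Suc k) - w ^ (N + Suc k) = w ^ (N - Suc k) * (1 - w ^ (2 * Suc k))"
      by (simp only: right_diff_distrib mult_1_right)
    then have "cmod (w ^ (N - Suc k) - w ^ (N + Suc k)) = cmod w ^ (N - Suc k) * cmod (1 - w ^ (2 * Suc k))"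
      by (metis norm_mult norm_power)
    also have "\<dots> \<le> 1 * (real (2 * Suc k) * \<delta>)"
      unfolding \<delta>_def by (intro mult_mono power_le_one norm_one_minus_power_le w) auto
    also have "\<dots> = 2 * \<delta> * real (Suc k)" by simp
    finally show ?thesis by (simp add: norm_divide pos_divide_le_eq del: of_nat_Suc)
  qed
  \<comment> \<open>The terms with \<open>k \<le> 1 / \<delta>\<close> are estimated one by one, the others by partial summation.\<close>
  define L where "L = min M N"
  have "cmod (\<Sum>k<L. ?g k) \<le> real (card {..<L}) * (2 * \<delta>)"
    by (rule sum_norm_bound) (use small in \<open>auto simp: L_def\<close>)
  also have "\<dots> = 2 * (\<delta> * real L)" by simp
  also have "\<dots> \<le> 2 * (\<delta> * real M)" using \<delta> by (intro mult_left_mono) (simp_all add: L_def)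
  also have "\<dots> \<le> 2" using M(1) by simp
  finally have head: "cmod (\<Sum>k<L. ?g k) \<le> 2" .
  have up: "cmod (\<Sum>k=M..<N. w ^ (N + Suc k) / of_nat (Suc k)) \<le> 2"
  proof (rule norm_fejer_half_tail_le[OF _ \<delta> M(2)])
    fix n
    have "(\<Sum>k=M..<n. w ^ (N + Suc k)) = (\<Sum>k=M + Suc N..<n + Suc N. w ^ k)"
      unfolding sum.shift_bounds_nat_ivl by (simp add: ac_simps)
    then show "cmod (\<Sum>k=M..<n. w ^ (N + Suc k)) \<le> 2 / \<delta>"
      using norm_geometric_sum_le[OF w False] by (simp only: \<delta>_def)
  qed
  have down: "cmod (\<Sum>k=M..<N. w ^ (N - Suc k) / of_nat (Suc k)) \<le> 2"
  proof (rule norm_fejer_half_tail_le[OF _ \<delta> M(2)])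
    fix n assume "n \<le> N"
    then have "(\<Sum>k=M..<n. w ^ (N - Suc k)) = (\<Sum>k=N - n..<N - M. w ^ k)"
      by (intro sum.reindex_bij_witness[of _ "\<lambda>k. N - Suc k" "\<lambda>k. N - Suc k"]) auto
    then show "cmod (\<Sum>k=M..<n. w ^ (N - Suc k)) \<le> 2 / \<delta>"
      using norm_geometric_sum_le[OF w False] by (simp only: \<delta>_def)
  qed
  have "(\<Sum>k<N. ?g k) = (\<Sum>k<L. ?g k) + (\<Sum>k=L..<N. ?g k)"
    by (simp add: L_def atLeast0LessThan[symmetric] sum.atLeastLessThan_concat)
  \<comment> \<open>If \<open>N < M\<close>, both index ranges are empty.\<close>
  moreover have "(\<Sum>k=L..<N. ?g k) = (\<Sum>k=M..<N. ?g k)"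
    by (rule sum.cong) (auto simp: L_def)
  moreover have "(\<Sum>k=M..<N. ?g k) = (\<Sum>k=M..<N. w ^ (N - Suc k) / of_nat (Suc k))
      - (\<Sum>k=M..<N. w ^ (N + Suc k) / of_nat (Suc k))"
    by (simp add: sum_subtractf diff_divide_distrib)
  ultimately have "(\<Sum>k<N. ?g k) = (\<Sum>k<L. ?g k) + ((\<Sum>k=M..<N. w ^ (N - Suc k) / of_nat (Suc k))
      - (\<Sum>k=M..<N. w ^ (N + Suc k) / of_nat (Suc k)))" by simp
  moreover have "cmod (x + (y - z)) \<le> 6" if "cmod x \<le> 2" "cmod y \<le> 2" "cmod z \<le> 2" for x y z
    using norm_triangle_ineq[of x "y - z"] norm_triangle_ineq4[of y z] that by linarith
  ultimately show ?thesis
    unfolding fejer_poly_eq using head down up by (simp only:)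
next
  case True
  then show ?thesis unfolding fejer_poly_eq by simp
qed

text \<open>Before the middle all coefficients are positive, so nothing cancels: this is the
  logarithmic growth that destroys convergence.\<close>

lemma sum_fejer_coeff: "(\<Sum>j<N. fejer_coeff N j) = harm N"
proof -
  have "(\<Sum>j<N. fejer_coeff N j) = (\<Sum>k<N. fejer_coeff N (N - Suc k))"
    by (rule sum.nat_diff_reindex[symmetric])
  also have "\<dots> = harm N"
    unfolding harm_altdef by (intro sum.cong) (auto simp: fejer_coeff_def of_nat_diff field_simps)
  finally show ?thesis .
qed

section \<open>Reading off coefficients from decay along the positive integers\<close>

text \<open>Convergence at 1 bounds the partial sums there; passing from 1 to \<open>Suc t\<close>
  multiplies the terms by decreasing weights, so partial summation applies.\<close>

lemma dirichlet_value_decay_of_leading_zeros: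
  assumes \<eta>: "frequency \<eta>" and a: "\<And>j. j < k \<Longrightarrow> a j = 0" 
    and sm: "\<And>t. summable (dirichlet_term \<eta> a (of_nat (Suc t)))"
  shows "\<exists>C. \<forall>t::nat. cmod (dirichlet_value \<eta> a (of_nat (Suc t))) \<le> C * exp (- \<eta> k * real t)"
proof -
  define c where "c = dirichlet_term \<eta> a 1"
  have "convergent (\<lambda>n. \<Sum>j<n. c j)"
    using sm[of 0] by (simp add: c_def summable_iff_convergent)
  then have "Bseq (\<lambda>n. \<Sum>j<n. c j)" by (rule convergent_imp_Bseq)
  then obtain C where C: "\<And>n. cmod (\<Sum>j<n. c j) \<le> C" by (auto simp: Bseq_def)
  have "cmod (dirichlet_value \<eta> a (of_nat (Suc t))) \<le> C * exp (- \<eta> k * real t)"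
    (is "cmod ?v \<le> _") for t
  proof -
    \<comment> \<open>The \<open>max\<close> makes the weights constant up to index
      \<open>k\<close>, so that \<open>d 0\<close> is already the desired rate. This changes
      nothing, since the terms before \<open>k\<close> vanish.\<close>
    define d where "d j = exp (- \<eta> (max j k) * real t)" for j
    have "decseq d"
      using \<eta> unfolding decseq_def d_def frequency_def
      by (auto simp: strict_mono_less_eq intro!: mult_right_mono)
    then have bd: "cmod (\<Sum>j<n. c j * of_real (d j)) \<le> C * d 0" for n
      by (rule norm_sum_decreasing_weights[OF C]) (simp add: d_def)
    have eq: "dirichlet_term \<eta> a (of_nat (Suc t)) j = c j * of_real (d j)" for j
      using a[of j]
      by (cases "j < k")
        (simp_all add: c_def d_def dirichlet_term_def max_def algebra_simps flip: exp_of_real exp_add)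
    have "(\<lambda>n. \<Sum>j<n. dirichlet_term \<eta> a (of_nat (Suc t)) j) \<longlonglongrightarrow> ?v"
      unfolding dirichlet_value_def by (rule summable_LIMSEQ[OF sm])
    then have "(\<lambda>n. \<Sum>j<n. c j * of_real (d j)) \<longlonglongrightarrow> ?v" by (simp only: eq)
    then have "cmod ?v \<le> C * d 0"
      by (rule tendsto_upperbound[OF tendsto_norm]) (use bd in auto)
    then show ?thesis by (simp add: d_def)
  qed
  then show ?thesis by blast
qed

text \<open>Once the earlier coefficients vanish, the \<open>m\<close>-th term is the difference of
  the whole series and the remainder after \<open>m\<close>. Both decay faster than
  \<open>exp (- \<eta> m * t)\<close>, the first by assumption and the second by the preceding
  lemma.\<close>

lemma dirichlet_coeff_eq_zero_of_decay:
  assumes \<eta>: "frequency \<eta>"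
    and sm: "\<And>t. summable (dirichlet_term \<eta> a (of_nat (Suc t)))"
    and bd: "\<And>t. cmod (dirichlet_value \<eta> a (of_nat (Suc t))) \<le> B * exp (- \<kappa> * real (Suc t))"
    and "\<eta> m < \<kappa>"
  shows "a m = 0"
  using \<open>\<eta> m < \<kappa>\<close>
proof (induction m rule: less_induct)
  case (less m)
  have mono: "strict_mono \<eta>" using \<eta> by (simp add: frequency_def)
  have zero: "a j = 0" if "j < m" for j
    using less.IH[OF that] less.prems strict_monoD[OF mono that] by linarith
  define a' where "a' = a(m := 0)"
  have sums': "dirichlet_term \<eta> a' z sums (dirichlet_value \<eta> a z - dirichlet_term \<eta> a z m)"
    if "summable (dirichlet_term \<eta> a z)" for z
  proof -
    have "(\<lambda>j. dirichlet_term \<eta> a z j - (if j = m then dirichlet_term \<eta> a z j else 0)) sums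
        (dirichlet_value \<eta> a z - dirichlet_term \<eta> a z m)"
      unfolding dirichlet_value_def by (intro sums_diff summable_sums that sums_single)
    moreover have "(\<lambda>j. dirichlet_term \<eta> a z j - (if j = m then dirichlet_term \<eta> a z j else 0))
        = dirichlet_term \<eta> a' z"
      by (auto simp: a'_def dirichlet_term_def)
    ultimately show ?thesis by simp
  qed
  have zero': "a' j = 0" if "j < Suc m" for j
    using zero that by (auto simp: a'_def less_Suc_eq)
  obtain C where C: "\<And>t. cmod (dirichlet_value \<eta> a' (of_nat (Suc t))) \<le> C * exp (- \<eta> (Suc m) * real t)"
    using dirichlet_value_decay_of_leading_zeros[OF \<eta> zero' sums_summable[OF sums'[OF sm]]] by blast
  \<comment> \<open>Multiplying by \<open>exp (\<eta> m * t)\<close> makes the left side independent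
    of \<open>t\<close> and leaves the two positive rates \<open>\<kappa> - \<eta> m\<close> and
    \<open>\<eta> (Suc m) - \<eta> m\<close> on the right.\<close>
  have est: "cmod (a m) * exp (- \<eta> m)
      \<le> B * exp (- \<kappa>) * exp (- (\<kappa> - \<eta> m) * real t) + C * exp (- (\<eta> (Suc m) - \<eta> m) * real t)" for t
  proof -
    let ?z = "of_nat (Suc t) :: complex"
    have "dirichlet_value \<eta> a ?z - dirichlet_term \<eta> a ?z m = dirichlet_value \<eta> a' ?z"
      unfolding dirichlet_value_def[of \<eta> a'] by (rule sums_unique[OF sums'[OF sm]])
    then have eq: "dirichlet_term \<eta> a ?z m = dirichlet_value \<eta> a ?z - dirichlet_value \<eta> a' ?z"
      by (auto simp: algebra_simps)
    have "cmod (dirichlet_term \<eta> a ?z m) \<le> B * exp (- \<kappa> * real (Suc t)) + C * exp (- \<eta> (Suc m) * real t)"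
      unfolding eq by (rule order_trans[OF norm_triangle_ineq4 add_mono[OF bd C]])
    then have "cmod (a m) * exp (- (\<eta> m * real (Suc t)))
        \<le> B * exp (- \<kappa> * real (Suc t)) + C * exp (- \<eta> (Suc m) * real t)"
      by (simp add: dirichlet_term_def norm_mult)
    then have "cmod (a m) * exp (- (\<eta> m * real (Suc t))) * exp (\<eta> m * real t)
        \<le> (B * exp (- \<kappa> * real (Suc t)) + C * exp (- \<eta> (Suc m) * real t)) * exp (\<eta> m * real t)"
      by (rule mult_right_mono) simp
    then show ?thesis
      by (simp add: mult.assoc algebra_simps flip: exp_add)
  qed
  have lim: "(\<lambda>t::nat. D * exp (- g * real t)) \<longlonglongrightarrow> 0" if "0 < g" for D g :: real
  proof -
    have "(\<lambda>t::nat. exp (- g) ^ t) \<longlonglongrightarrow> 0" using that by (intro LIMSEQ_realpow_zero) auto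
    then have "(\<lambda>t::nat. D * exp (- g) ^ t) \<longlonglongrightarrow> D * 0" by (rule tendsto_mult_left)
    then show ?thesis by (simp add: mult.commute flip: exp_of_nat_mult)
  qed
  have "(\<lambda>t. B * exp (- \<kappa>) * exp (- (\<kappa> - \<eta> m) * real t) + C * exp (- (\<eta> (Suc m) - \<eta> m) * real t))
      \<longlonglongrightarrow> 0 + 0"
    using less.prems strict_monoD[OF mono, of m "Suc m"] by (intro tendsto_add lim) auto
  then have "cmod (a m) * exp (- \<eta> m) \<le> 0 + 0"
    by (rule tendsto_lowerbound) (use est in auto)
  then show ?case by (simp add: mult_le_0_iff)
qed

section \<open>Explicit enumeration of the refined frequency by blocks\<close>

definition block_start :: "(nat \<Rightarrow> nat) \<Rightarrow> nat \<Rightarrow> nat" where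
  "block_start s n = (\<Sum>i<n. s i)"

definition block_index :: "(nat \<Rightarrow> nat) \<Rightarrow> nat \<Rightarrow> nat" where
  "block_index s m = (LEAST n. m < block_start s (Suc n))"

definition refined_frequency :: "(nat \<Rightarrow> real) \<Rightarrow> (nat \<Rightarrow> nat) \<Rightarrow> nat \<Rightarrow> real" where
  "refined_frequency \<Lambda> s m = (let n = block_index s m in
     \<Lambda> n + real (m - block_start s n) / real (s n) * (\<Lambda> (Suc n) - \<Lambda> n))"

lemma block_start_Suc: "block_start s (Suc n) = block_start s n + s n"
  by (simp add: block_start_def)

lemma block_start_mono: "i \<le> k \<Longrightarrow> block_start s i \<le> block_start s k"
  unfolding block_start_def by (rule sum_mono2) auto

lemma block_index_eq:
  assumes "j < s n"
  shows "block_index s (block_start s n + j) = n"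
  unfolding block_index_def
proof (rule Least_equality)
  show "block_start s n + j < block_start s (Suc n)" using assms by (simp add: block_start_Suc)
  fix k assume "block_start s n + j < block_start s (Suc k)"
  then show "n \<le> k" using block_start_mono[of "Suc k" n s] by (cases "n \<le> k") auto
qed

lemma block_decomposition:
  assumes "\<And>n. 1 \<le> s n"
  shows "\<exists>n j. j < s n \<and> m = block_start s n + j"
proof (induction m)
  case 0
  have "0 < s 0" using assms[of 0] by simp
  then show ?case by (intro exI[of _ 0] exI[of _ "0::nat"]) (simp add: block_start_def)
next
  case (Suc m)
  then obtain n j where nj: "j < s n" "m = block_start s n + j" by blast
  show ?case
  proof (cases "Suc j < s n")
    case True
    then show ?thesis using nj by (intro exI[of _ n] exI[of _ "Suc j"]) simp
  next
    case False
    then show ?thesis using nj assms[of "Suc n"]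
      by (intro exI[of _ "Suc n"] exI[of _ "0::nat"]) (simp add: block_start_Suc)
  qed
qed

lemma sum_block_start:
  fixes f :: "nat \<Rightarrow> 'a::comm_monoid_add"
  shows "(\<Sum>m<block_start s K. f m) = (\<Sum>n<K. \<Sum>j<s n. f (block_start s n + j))"
  by (induction K) (simp_all add: block_start_Suc sum_lessThan_add, simp add: block_start_def)

lemma refined_frequency_block:
  assumes "j < s n"
  shows "refined_frequency \<Lambda> s (block_start s n + j) = \<Lambda> n + real j / real (s n) * (\<Lambda> (Suc n) - \<Lambda> n)"
  using block_index_eq[of j s n, OF assms] by (simp add: refined_frequency_def)

text \<open>The upper bound is strict because \<open>j / s n < 1\<close>. It separates consecutive
  blocks, and later places every exponent of block \<open>n\<close> below the decay rate
  \<open>\<Lambda> (Suc n)\<close>.\<close>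

lemma refined_frequency_bounds:
  assumes "frequency \<Lambda>" "j < s n"
  shows "\<Lambda> n \<le> refined_frequency \<Lambda> s (block_start s n + j)"
    and "refined_frequency \<Lambda> s (block_start s n + j) < \<Lambda> (Suc n)"
proof -
  have d: "0 < \<Lambda> (Suc n) - \<Lambda> n" using assms(1) by (simp add: frequency_def strict_mono_less)
  have "real j / real (s n) < 1" using assms(2) by simp
  then have "real j / real (s n) * (\<Lambda> (Suc n) - \<Lambda> n) < 1 * (\<Lambda> (Suc n) - \<Lambda> n)"
    using d by (rule mult_strict_right_mono)
  then show "refined_frequency \<Lambda> s (block_start s n + j) < \<Lambda> (Suc n)"
    using assms(2) by (simp add: refined_frequency_block)
  show "\<Lambda> n \<le> refined_frequency \<Lambda> s (block_start s n + j)"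
    using d assms(2) by (simp add: refined_frequency_block)
qed

lemma frequency_refined:
  assumes \<Lambda>: "frequency \<Lambda>" and s: "\<And>n. 1 \<le> s n"
  shows "frequency (refined_frequency \<Lambda> s)"
proof -
  let ?\<eta> = "refined_frequency \<Lambda> s"
  have sm: "strict_mono ?\<eta>"
  proof (subst strict_mono_Suc_iff, intro allI)
    fix m
    obtain n j where nj: "j < s n" "m = block_start s n + j" using block_decomposition[of s m, OF s] by blast
    show "?\<eta> m < ?\<eta> (Suc m)"
    proof (cases "Suc j < s n")
      case True
      have "\<Lambda> n < \<Lambda> (Suc n)" using \<Lambda> by (simp add: frequency_def strict_mono_less)
      then show ?thesis
        using nj True refined_frequency_block[of j s n \<Lambda>] refined_frequency_block[of "Suc j" s n \<Lambda>]
        by (simp add: divide_strict_right_mono)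
    next
      \<comment> \<open>Here \<open>m\<close> is the last index of block \<open>n\<close>, and its
        successor opens block \<open>Suc n\<close>.\<close>
      case False
      then have "Suc m = block_start s (Suc n) + 0" using nj by (simp add: block_start_Suc)
      moreover have "0 < s (Suc n)" using s[of "Suc n"] by simp
      ultimately show ?thesis
        using nj refined_frequency_bounds(2)[OF \<Lambda>, of j s n] refined_frequency_bounds(1)[OF \<Lambda>, of 0 s "Suc n"]
        by simp
    qed
  qed
  moreover have "0 \<le> ?\<eta> m" for m
  proof -
    obtain n j where nj: "j < s n" "m = block_start s n + j" using block_decomposition[of s m, OF s] by blast
    then show ?thesis
      using refined_frequency_bounds(1)[OF \<Lambda>, of j s n] \<Lambda> by (auto simp: frequency_def intro: order_trans)
  qed
  moreover have "filterlim ?\<eta> at_top sequentially"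
    unfolding filterlim_at_top eventually_sequentially
  proof
    fix x
    obtain n where n: "x \<le> \<Lambda> n"
      using \<Lambda> unfolding frequency_def filterlim_at_top eventually_sequentially by blast
    have "x \<le> ?\<eta> m" if "block_start s n \<le> m" for m
    proof -
      have "\<Lambda> n \<le> ?\<eta> (block_start s n + 0)" using refined_frequency_bounds(1)[OF \<Lambda>, of 0 s n] s[of n] by simp
      also have "\<dots> \<le> ?\<eta> m" using sm that by (simp add: strict_mono_less_eq)
      finally show ?thesis using n by linarith
    qed
    then show "\<exists>N. \<forall>m\<ge>N. x \<le> ?\<eta> m" by blast
  qed
  ultimately show ?thesis by (simp add: frequency_def)
qed

lemma range_refined_frequency:
  assumes "\<And>n. 1 \<le> s n"
  shows "range (refined_frequency \<Lambda> s) = refinement \<Lambda> s"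
proof
  show "range (refined_frequency \<Lambda> s) \<subseteq> refinement \<Lambda> s"
  proof
    fix x assume "x \<in> range (refined_frequency \<Lambda> s)"
    then obtain m where "x = refined_frequency \<Lambda> s m" by blast
    moreover obtain n j where "j < s n" "m = block_start s n + j" using block_decomposition[of s m, OF assms] by blast
    ultimately show "x \<in> refinement \<Lambda> s" by (auto simp: refinement_def refined_frequency_block)
  qed
  show "refinement \<Lambda> s \<subseteq> range (refined_frequency \<Lambda> s)"
  proof
    fix x assume "x \<in> refinement \<Lambda> s"
    then obtain n j where "j < s n" "x = \<Lambda> n + real j / real (s n) * (\<Lambda> (Suc n) - \<Lambda> n)"
      by (auto simp: refinement_def)
    then have "x = refined_frequency \<Lambda> s (block_start s n + j)" by (simp add: refined_frequency_block)
    then show "x \<in> range (refined_frequency \<Lambda> s)" by blast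
  qed
qed

section \<open>The Cauchy sequence of truncated block sums\<close>

text \<open>In \<open>harm_large\<close> the factor \<open>2 ^ n\<close> compensates the weight of
  the \<open>n\<close>-th block, and \<open>exp (\<Lambda> (Suc n))\<close> compensates the
  exponential factors of its terms at the point 1.\<close>

locale fejer_blocks =
  fixes \<Lambda> :: "nat \<Rightarrow> real" and N :: "nat \<Rightarrow> nat"
  assumes freq: "frequency \<Lambda>"
    and harm_large: "\<And>n. 2 ^ n * exp (\<Lambda> (Suc n)) \<le> harm (N n)"
begin

text \<open>A polynomial of degree \<open>2 * N n\<close> has this many coefficients, so it fills
  its block exactly.\<close>

definition s :: "nat \<Rightarrow> nat" where
  "s n = 2 * N n + 1"

definition \<eta> :: "nat \<Rightarrow> real" where
  "\<eta> = refined_frequency \<Lambda> s"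

definition coeff :: "nat \<Rightarrow> complex" where
  "coeff m = (let n = block_index s m in of_real (fejer_coeff (N n) (m - block_start s n) / 2 ^ n))"

definition truncation :: "nat \<Rightarrow> nat \<Rightarrow> complex" where
  "truncation K m = (if m < block_start s K then coeff m else 0)"

definition block :: "nat \<Rightarrow> complex \<Rightarrow> complex" where
  "block n z = (\<Sum>j<s n. dirichlet_term \<eta> coeff z (block_start s n + j))"

lemma s_pos: "1 \<le> s n"
  by (simp add: s_def)

lemma frequency_\<eta>: "frequency \<eta>"
  unfolding \<eta>_def by (rule frequency_refined[OF freq s_pos])

lemma coeff_block:
  assumes "j < s n"
  shows "coeff (block_start s n + j) = of_real (fejer_coeff (N n) j / 2 ^ n)"
  using block_index_eq[of j s n, OF assms] by (simp add: coeff_def)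

text \<open>The exponents of a block form an arithmetic progression with step \<open>g\<close>. Thus
  the block is \<open>exp (- \<Lambda> n * z) / 2 ^ n\<close> times the Fejer polynomial at
  \<open>w = exp (- g * z)\<close>, a point of the unit disc.\<close>

lemma norm_block_le:
  assumes z: "0 < Re z"
  shows "cmod (block n z) \<le> 6 * exp (- \<Lambda> n * Re z) / 2 ^ n"
proof -
  define g where "g = (\<Lambda> (Suc n) - \<Lambda> n) / real (s n)"
  have "0 \<le> g" using freq s_pos[of n] by (simp add: g_def frequency_def strict_mono_less_eq)
  define w where "w = exp (- (of_real g * z))"
  have w: "cmod w \<le> 1" using z \<open>0 \<le> g\<close> by (simp add: w_def)
  have "dirichlet_term \<eta> coeff z (block_start s n + j)
      = exp (- (of_real (\<Lambda> n) * z)) / 2 ^ n * (of_real (fejer_coeff (N n) j) * w ^ j)" if "j < s n" for j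
  proof -
    have "\<eta> (block_start s n + j) = \<Lambda> n + real j * g"
      using that by (simp add: \<eta>_def refined_frequency_block g_def)
    then have "exp (- (of_real (\<eta> (block_start s n + j)) * z)) = exp (- (of_real (\<Lambda> n) * z)) * w ^ j"
      by (simp add: w_def algebra_simps flip: exp_add exp_of_nat_mult)
    then show ?thesis using that by (simp add: dirichlet_term_def coeff_block)
  qed
  then have "block n z = (\<Sum>j<s n. exp (- (of_real (\<Lambda> n) * z)) / 2 ^ n * (of_real (fejer_coeff (N n) j) * w ^ j))"
    unfolding block_def by (intro sum.cong) auto
  also have "\<dots> = exp (- (of_real (\<Lambda> n) * z)) / 2 ^ n * (\<Sum>j<2 * N n + 1. of_real (fejer_coeff (N n) j) * w ^ j)"
    unfolding s_def by (rule sum_distrib_left[symmetric])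
  finally have "cmod (block n z) = exp (- \<Lambda> n * Re z) / 2 ^ n
      * cmod (\<Sum>j<2 * N n + 1. of_real (fejer_coeff (N n) j) * w ^ j)"
    by (simp only: norm_mult norm_divide norm_power) simp
  also have "\<dots> \<le> exp (- \<Lambda> n * Re z) / 2 ^ n * 6"
    by (intro mult_left_mono norm_fejer_poly_le w) simp
  finally show ?thesis by (simp add: mult.commute)
qed

text \<open>The weights sum geometrically, which doubles the constant 6. The exponential factor is
  retained because its decay will identify the coefficients of a limit.\<close>

lemma norm_block_sum_le:
  assumes z: "0 < Re z" and "K \<le> M"
  shows "cmod (\<Sum>n=K..<M. block n z) \<le> 12 * exp (- \<Lambda> K * Re z) / 2 ^ K"
proof -
  have "cmod (\<Sum>n=K..<M. block n z) \<le> (\<Sum>n=K..<M. 6 * exp (- \<Lambda> K * Re z) * (1 / 2 ^ n))"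
  proof (rule sum_norm_le)
    fix n assume n: "n \<in> {K..<M}"
    have "exp (- \<Lambda> n * Re z) \<le> exp (- \<Lambda> K * Re z)"
      using n z freq by (simp add: frequency_def strict_mono_less_eq)
    then have "6 * exp (- \<Lambda> n * Re z) / 2 ^ n \<le> 6 * exp (- \<Lambda> K * Re z) / 2 ^ n"
      by (intro divide_right_mono) auto
    then show "cmod (block n z) \<le> 6 * exp (- \<Lambda> K * Re z) * (1 / 2 ^ n)"
      using norm_block_le[OF z, of n] by simp
  qed
  also have "\<dots> = 6 * exp (- \<Lambda> K * Re z) * (\<Sum>n=K..<M. 1 / 2 ^ n)"
    by (rule sum_distrib_left[symmetric])
  also have "(\<Sum>n=K..<M. 1 / 2 ^ n :: real) = 2 / 2 ^ K - 2 / 2 ^ M"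
    using \<open>K \<le> M\<close> by (induction rule: dec_induct) simp_all
  also have "6 * exp (- \<Lambda> K * Re z) * (2 / 2 ^ K - 2 / 2 ^ M) \<le> 6 * exp (- \<Lambda> K * Re z) * (2 / 2 ^ K)"
    by (intro mult_left_mono) auto
  finally show ?thesis by simp
qed

lemma truncation_sums: "dirichlet_term \<eta> (truncation K) z sums (\<Sum>n<K. block n z)"
proof -
  have "dirichlet_term \<eta> (truncation K) z sums (\<Sum>m<block_start s K. dirichlet_term \<eta> (truncation K) z m)"
    by (rule sums_finite) (auto simp: dirichlet_term_def truncation_def)
  also have "(\<Sum>m<block_start s K. dirichlet_term \<eta> (truncation K) z m) = (\<Sum>m<block_start s K. dirichlet_term \<eta> coeff z m)"
    by (intro sum.cong) (auto simp: dirichlet_term_def truncation_def)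
  finally show ?thesis by (simp only: sum_block_start block_def)
qed

lemma truncation_value: "dirichlet_value \<eta> (truncation K) z = (\<Sum>n<K. block n z)"
  unfolding dirichlet_value_def by (rule sums_unique[OF truncation_sums, symmetric])

lemma truncation_value_diff:
  assumes "0 < Re z" "K \<le> M"
  shows "cmod (dirichlet_value \<eta> (truncation M) z - dirichlet_value \<eta> (truncation K) z)
    \<le> 12 * exp (- \<Lambda> K * Re z) / 2 ^ K"
proof -
  have "(\<Sum>n<M. block n z) = (\<Sum>n<K. block n z) + (\<Sum>n=K..<M. block n z)"
    using assms(2) by (simp add: atLeast0LessThan[symmetric] sum.atLeastLessThan_concat)
  then show ?thesis using norm_block_sum_le[OF assms] by (simp add: truncation_value)
qed

lemma exp_decay_le_one: "0 < Re z \<Longrightarrow> exp (- \<Lambda> K * Re z) \<le> 1"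
  using freq by (simp add: frequency_def)

lemma truncation_in_D_infty: "truncation K \<in> D_infty \<eta>"
proof -
  \<comment> \<open>Comparison with \<open>truncation 0\<close>, whose value is an empty
    sum.\<close>
  have "cmod (dirichlet_value \<eta> (truncation K) z) \<le> 12" if "0 < Re z" for z
    using truncation_value_diff[OF that, of 0 K] exp_decay_le_one[OF that, of 0]
    by (simp add: truncation_value del: exp_le_one_iff)
  then show ?thesis
    using truncation_sums by (auto simp: D_infty_def bounded_iff summable_def)
qed

lemma truncation_dist_le:
  assumes "K \<le> M"
  shows "D_infty_dist \<eta> (truncation K) (truncation M) \<le> 12 / 2 ^ K"
proof -
  have "D_infty_norm \<eta> (\<lambda>m. truncation K m - truncation M m) \<le> 12 / 2 ^ K"
  proof (rule D_infty_norm_least)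
    fix z :: complex assume z: "0 < Re z"
    have "12 * exp (- \<Lambda> K * Re z) / 2 ^ K \<le> 12 * 1 / 2 ^ K"
      by (intro divide_right_mono mult_left_mono exp_decay_le_one z) auto
    then show "cmod (dirichlet_value \<eta> (\<lambda>m. truncation K m - truncation M m) z) \<le> 12 / 2 ^ K"
      using truncation_value_diff[OF z assms]
      by (simp add: D_infty_diff(2)[OF truncation_in_D_infty truncation_in_D_infty z] norm_minus_commute)
  qed
  then show ?thesis by (simp add: D_infty_dist_def truncation_in_D_infty)
qed

sublocale Metric_space "D_infty \<eta>" "D_infty_dist \<eta>"
  by (rule Metric_space_D_infty[OF frequency_\<eta>])

lemma MCauchy_truncation: "MCauchy truncation"
  unfolding MCauchy_def
proof (intro conjI allI impI)
  show "range truncation \<subseteq> D_infty \<eta>" using truncation_in_D_infty by blast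
  fix \<epsilon> :: real assume "0 < \<epsilon>"
  then obtain K where "(1 / 2) ^ K < \<epsilon> / 12" using real_arch_pow_inv[of "\<epsilon> / 12" "1 / 2"] by auto
  then have K: "12 / 2 ^ K < \<epsilon>" by (simp add: power_one_over field_simps)
  have "D_infty_dist \<eta> (truncation n) (truncation n') < \<epsilon>" if "K \<le> n" "n \<le> n'" for n n'
  proof -
    have "12 / 2 ^ n \<le> (12 / 2 ^ K :: real)" using that by (intro divide_left_mono power_increasing) auto
    then show ?thesis using truncation_dist_le[OF that(2)] K by linarith
  qed
  then show "\<exists>K. \<forall>n n'. K \<le> n \<longrightarrow> K \<le> n' \<longrightarrow> D_infty_dist \<eta> (truncation n) (truncation n') < \<epsilon>"
    by (metis commute nle_le)
qed

section \<open>Identification of the limit and its divergence at 1\<close>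

text \<open>Norm convergence carries the estimate between two truncations over to \<open>b\<close>
  and one truncation. The difference of \<open>b\<close> and \<open>truncation (Suc n)\<close>
  therefore decays at rate \<open>\<Lambda> (Suc n)\<close>, so its coefficients in the blocks up to
  \<open>n\<close> vanish.\<close>

lemma limit_eq_coeff:
  assumes lim: "limitin mtopology truncation b sequentially"
  shows "b = coeff"
proof
  fix m
  have b: "b \<in> D_infty \<eta>"
    and near: "\<And>\<epsilon>. 0 < \<epsilon> \<Longrightarrow> \<exists>K. \<forall>n\<ge>K. D_infty_dist \<eta> (truncation n) b < \<epsilon>"
    using lim unfolding limit_metric_sequentially by blast+
  have close: "cmod (dirichlet_value \<eta> b z - dirichlet_value \<eta> (truncation K) z)
      \<le> 12 * exp (- \<Lambda> K * Re z) / 2 ^ K" if z: "0 < Re z" for z K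
  proof (rule field_le_epsilon)
    fix \<epsilon> :: real assume "0 < \<epsilon>"
    then obtain M0 where "\<forall>n\<ge>M0. D_infty_dist \<eta> (truncation n) b < \<epsilon>" using near by blast
    \<comment> \<open>An index beyond \<open>M0\<close> is close to \<open>b\<close>, and one beyond
      \<open>K\<close> can be compared with \<open>truncation K\<close>.\<close>
    then have "D_infty_dist \<eta> (truncation (max M0 K)) b < \<epsilon>" by simp
    then have "D_infty_norm \<eta> (\<lambda>m. truncation (max M0 K) m - b m) < \<epsilon>"
      using b by (simp add: D_infty_dist_def truncation_in_D_infty)
    then have "cmod (dirichlet_value \<eta> (truncation (max M0 K)) z - dirichlet_value \<eta> b z) < \<epsilon>"
      using D_infty_norm_upper[OF D_infty_diff(1)[OF truncation_in_D_infty b] z, of "max M0 K"]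
      by (simp add: D_infty_diff(2)[OF truncation_in_D_infty b z])
    moreover have "cmod (dirichlet_value \<eta> (truncation (max M0 K)) z - dirichlet_value \<eta> (truncation K) z)
        \<le> 12 * exp (- \<Lambda> K * Re z) / 2 ^ K"
      by (rule truncation_value_diff[OF z]) simp
    ultimately show "cmod (dirichlet_value \<eta> b z - dirichlet_value \<eta> (truncation K) z)
        \<le> 12 * exp (- \<Lambda> K * Re z) / 2 ^ K + \<epsilon>"
      using norm_triangle_sub[of "dirichlet_value \<eta> b z - dirichlet_value \<eta> (truncation K) z"
          "dirichlet_value \<eta> (truncation (max M0 K)) z - dirichlet_value \<eta> (truncation K) z"]
      by (simp add: norm_minus_commute)
  qed
  obtain n j where nj: "j < s n" "m = block_start s n + j"
    using block_decomposition[of s m, OF s_pos] by blast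
  let ?a = "\<lambda>m. b m - truncation (Suc n) m"
  have a: "?a \<in> D_infty \<eta>" by (rule D_infty_diff(1)[OF b truncation_in_D_infty])
  have "?a m = 0"
  proof (rule dirichlet_coeff_eq_zero_of_decay[OF frequency_\<eta>])
    fix t
    have pos: "0 < Re (of_nat (Suc t))" by simp
    show "summable (dirichlet_term \<eta> ?a (of_nat (Suc t)))"
      using a pos unfolding D_infty_def by blast
    show "cmod (dirichlet_value \<eta> ?a (of_nat (Suc t))) \<le> 12 / 2 ^ Suc n * exp (- \<Lambda> (Suc n) * real (Suc t))"
      using close[OF pos, of "Suc n"] unfolding D_infty_diff(2)[OF b truncation_in_D_infty pos] by simp
  next
    show "\<eta> m < \<Lambda> (Suc n)"
      using nj refined_frequency_bounds(2)[OF freq] by (simp add: \<eta>_def)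
  qed
  then show "b m = coeff m" using nj by (simp add: truncation_def block_start_Suc)
qed

text \<open>The Cauchy criterion fails on the first half of every block, where the terms at 1 are
  positive and sum to at least 1.\<close>

lemma not_summable_coeff: "\<not> summable (dirichlet_term \<eta> coeff 1)"
proof
  assume "summable (dirichlet_term \<eta> coeff 1)"
  then obtain n where n: "\<And>l k. n \<le> l \<Longrightarrow> cmod (\<Sum>m=l..<k. dirichlet_term \<eta> coeff 1 m) < 1"
    unfolding summable_Cauchy using zero_less_one by blast
  \<comment> \<open>Blocks are nonempty, so block \<open>n\<close> starts at or after index
    \<open>n\<close> and the Cauchy bound covers its first half.\<close>
  have "n = (\<Sum>i<n. 1)" by simp
  also have "\<dots> \<le> block_start s n" unfolding block_start_def by (intro sum_mono s_pos)
  finally have small: "cmod (\<Sum>m=block_start s n..<block_start s n + N n. dirichlet_term \<eta> coeff 1 m) < 1"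
    by (rule n)
  have "1 \<le> exp (- \<Lambda> (Suc n)) / 2 ^ n * harm (N n)"
    using harm_large[of n] by (simp add: exp_minus field_simps)
  also have "\<dots> = (\<Sum>j<N n. exp (- \<Lambda> (Suc n)) / 2 ^ n * fejer_coeff (N n) j)"
    by (simp only: sum_distrib_left sum_fejer_coeff[symmetric])
  also have "\<dots> \<le> (\<Sum>j<N n. exp (- \<eta> (block_start s n + j)) / 2 ^ n * fejer_coeff (N n) j)"
  proof (rule sum_mono)
    fix j assume j: "j \<in> {..<N n}"
    then have "j < s n" by (simp add: s_def)
    then have "exp (- \<Lambda> (Suc n)) \<le> exp (- \<eta> (block_start s n + j))"
      using refined_frequency_bounds(2)[OF freq, of j s n] by (simp add: \<eta>_def)
    then show "exp (- \<Lambda> (Suc n)) / 2 ^ n * fejer_coeff (N n) j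
        \<le> exp (- \<eta> (block_start s n + j)) / 2 ^ n * fejer_coeff (N n) j"
      using j by (intro mult_right_mono divide_right_mono) (auto simp: fejer_coeff_def)
  qed
  also have "\<dots> \<le> cmod (of_real (\<Sum>j<N n. exp (- \<eta> (block_start s n + j)) / 2 ^ n * fejer_coeff (N n) j))"
    unfolding norm_of_real by simp
  also have "of_real (\<Sum>j<N n. exp (- \<eta> (block_start s n + j)) / 2 ^ n * fejer_coeff (N n) j)
      = (\<Sum>j<N n. dirichlet_term \<eta> coeff 1 (block_start s n + j))"
    unfolding of_real_sum
    by (intro sum.cong) (auto simp: dirichlet_term_def coeff_block s_def simp flip: exp_of_real)
  also have "\<dots> = (\<Sum>m=block_start s n..<block_start s n + N n. dirichlet_term \<eta> coeff 1 m)"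
    using sum.shift_bounds_nat_ivl[of "dirichlet_term \<eta> coeff 1" 0 "block_start s n" "N n"]
    by (simp add: add.commute atLeast0LessThan)
  finally show False using small by simp
qed

lemma not_mcomplete: "\<not> mcomplete"
proof
  assume mcomplete
  then obtain b where lim: "limitin mtopology truncation b sequentially"
    using MCauchy_truncation unfolding mcomplete_def by blast
  then have "coeff \<in> D_infty \<eta>"
    using limit_eq_coeff limit_metric_sequentially by blast
  then show False using not_summable_coeff by (simp add: D_infty_def)
qed

end

text \<open>Harmonic numbers are unbounded and monotone, so indices may be enlarged freely. Summing
  the values \<open>Suc (f i)\<close> yields strict growth while staying above
  \<open>f n\<close>.\<close>

lemma ex_strict_mono_harm_ge: "\<exists>N :: nat \<Rightarrow> nat. strict_mono N \<and> (\<forall>n. B n \<le> (harm (N n) :: real))"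
proof -
  have "\<exists>k. x \<le> (harm k :: real)" for x
    using harm_at_top unfolding filterlim_at_top eventually_sequentially by blast
  then have "\<forall>n. \<exists>k. B n \<le> (harm k :: real)" by blast
  then obtain f where f: "\<And>n. B n \<le> (harm (f n) :: real)" by metis
  define N where "N n = (\<Sum>i\<le>n. Suc (f i))" for n
  have "strict_mono N" by (simp add: strict_mono_Suc_iff N_def)
  moreover have "B n \<le> harm (N n)" for n
  proof -
    have "f n \<le> N n" unfolding N_def using member_le_sum[of n "{..n}" "\<lambda>i. Suc (f i)"] by simp
    then show ?thesis using f[of n] harm_mono[of "f n" "N n"] by (meson order_trans)
  qed
  ultimately show ?thesis by blast
qed

theorem theorem5p2:
  fixes \<Lambda> :: "nat \<Rightarrow> real"
  assumes "frequency \<Lambda>"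
  shows "\<exists>s :: nat \<Rightarrow> nat. strict_mono s \<and> (\<forall>n. 1 \<le> s n) \<and>
           (\<exists>\<eta>. frequency \<eta> \<and> range \<eta> = refinement \<Lambda> s \<and>
                \<not> Metric_space.mcomplete (D_infty \<eta>) (D_infty_dist \<eta>))"
proof -
  obtain N where N: "strict_mono N" "\<And>n. 2 ^ n * exp (\<Lambda> (Suc n)) \<le> harm (N n)"
    using ex_strict_mono_harm_ge[of "\<lambda>n. 2 ^ n * exp (\<Lambda> (Suc n))"] by blast
  interpret fejer_blocks \<Lambda> N
    by unfold_locales (use assms N(2) in auto)
  have "strict_mono s" using N(1) by (simp add: s_def strict_mono_def)
  moreover have "range \<eta> = refinement \<Lambda> s" unfolding \<eta>_def by (rule range_refined_frequency[OF s_pos])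
  ultimately show ?thesis
    using s_pos frequency_\<eta> not_mcomplete by blast
qed

end
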